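(* There exists $C>0$ such that for all integers $N\ge 3$ and all primes $p$, $$\mathrm{Diam}\ \mathrm{Cay}(\mathrm{SL}_N(\mathbb{F}_p),\{e_{ij}\mid 1\le i,j\le N,\ i\ne j\})\ \le\ C N^2\log p.$$
   Context: For $i\neq j$, $e_{ij}$ denotes the $N\times N$ elementary matrix with $1$'s along the diagonal, $ij$-entry equal to $1$, and all other entries $0$. For a finite group $G$ with generating set $X$, $\mathrm{Diam}\ \mathrm{Cay}(G,X)$ is the diameter of the (undirected) Cayley graph, i.e. the least $d$ such that every element of $G$ is represented by a word of length at most $d$ in $X\cup X^{-1}$. *)

theory Defs
  imports
    Jordan_Normal_Form.Determinant
    "HOL-Number_Theory.Residues"
    "HOL-Library.Extended_Real"
begin

text \<open>
  An element of \<open>\<F>\<^sub>p\<close> is its representative in \<open>{0..p-1}\<close>, as in \<^const>\<open>residue_ring\<close>.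
  Sums, products and hence determinants over \<open>\<F>\<^sub>p\<close> are the integer ones reduced modulo \<open>p\<close>.
  Row and column indices run from \<open>0\<close> to \<open>N-1\<close>.
\<close>

definition reduce_mat :: "nat \<Rightarrow> int mat \<Rightarrow> int mat" where
  "reduce_mat p A = map_mat (\<lambda>x. x mod int p) A"

definition SL :: "nat \<Rightarrow> nat \<Rightarrow> int mat monoid" where
  "SL N p = \<lparr>carrier = {A \<in> carrier_mat N N.
                 elements_mat A \<subseteq> carrier (residue_ring (int p)) \<and> [det A = 1] (mod int p)},
             monoid.mult = (\<lambda>A B. reduce_mat p (A * B)),
             one = 1\<^sub>m N\<rparr>"

definition elementary_mat :: "nat \<Rightarrow> nat \<Rightarrow> nat \<Rightarrow> int mat" where
  "elementary_mat N i j = mat N N (\<lambda>(a, b). if a = b \<or> (a = i \<and> b = j) then 1 else 0)"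

definition represents_elem :: "('a, 'b) monoid_scheme \<Rightarrow> 'a set \<Rightarrow> 'a list \<Rightarrow> 'a \<Rightarrow> bool" where
  "represents_elem G X w g \<longleftrightarrow>
     set w \<subseteq> X \<union> m_inv G ` X \<and> foldr (monoid.mult G) w (one G) = g"

text \<open>The diameter is \<open>\<infinity>\<close> if no \<open>d\<close> works, in particular if \<open>X\<close> does not generate \<open>G\<close>.\<close>

definition cayley_diam :: "('a, 'b) monoid_scheme \<Rightarrow> 'a set \<Rightarrow> enat" where
  "cayley_diam G X =
     Inf {enat d | d. \<forall>g \<in> carrier G. \<exists>w. length w \<le> d \<and> represents_elem G X w g}"

lemma SL_carrier_iff:
  assumes "prime p"
  shows "A \<in> carrier (SL N p) \<longleftrightarrow> A \<in> carrier_mat N N \<and> reduce_mat p A = A \<and> [det A = 1] (mod int p)"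
proof -
  have p: "int p > 0" using prime_gt_0_nat[OF assms] by simp
  have "elements_mat A \<subseteq> {0..int p - 1} \<longleftrightarrow> reduce_mat p A = A" if A: "A \<in> carrier_mat N N"
  proof
    assume "elements_mat A \<subseteq> {0..int p - 1}"
    then have "\<And>i j. i < N \<Longrightarrow> j < N \<Longrightarrow> A $$ (i,j) \<in> {0..int p - 1}"
      using A by (meson elements_matI subsetD)
    then show "reduce_mat p A = A"
      using A by (intro eq_matI) (auto simp: reduce_mat_def)
  next
    assume r: "reduce_mat p A = A"
    have "A $$ (i,j) \<in> {0..int p - 1}" if "i < dim_row A" "j < dim_col A" for i j
    proof -
      have "A $$ (i,j) = reduce_mat p A $$ (i,j)" using r by simp
      also have "\<dots> = A $$ (i,j) mod int p" using that by (simp add: reduce_mat_def)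
      finally show ?thesis using p by (metis atLeastAtMost_iff pos_mod_bound pos_mod_sign zle_diff1_eq)
    qed
    then show "elements_mat A \<subseteq> {0..int p - 1}" by (auto dest!: elements_matD)
  qed
  then show ?thesis by (auto simp: SL_def residue_ring_def)
qed

lemma reduce_mat_carrier [simp]: "reduce_mat p A \<in> carrier_mat n m \<longleftrightarrow> A \<in> carrier_mat n m"
  by (simp add: reduce_mat_def)

lemma reduce_mat_idem [simp]: "reduce_mat p (reduce_mat p A) = reduce_mat p A"
  by (intro eq_matI) (auto simp: reduce_mat_def)

lemma det_reduce_mat: "[det (reduce_mat p A) = det A] (mod int p)"
proof (cases "dim_row A = dim_col A")
  case True
  have "[(\<Prod>i = 0..<dim_row A. A $$ (i, q i) mod int p) = (\<Prod>i = 0..<dim_row A. A $$ (i, q i))] (mod int p)"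
    for q by (intro cong_prod) (simp add: cong_def)
  moreover have "(\<Prod>i = 0..<dim_row A. reduce_mat p A $$ (i, q i)) = (\<Prod>i = 0..<dim_row A. A $$ (i, q i) mod int p)"
    if "q permutes {0..<dim_row A}" for q
    using True permutes_in_image[OF that]
    by (intro prod.cong) (auto simp: reduce_mat_def)
  ultimately show ?thesis
    using True unfolding det_def
    by (auto simp: reduce_mat_def intro!: cong_sum cong_mult)
qed (simp add: det_def reduce_mat_def)

lemma reduce_mat_mult_left:
  assumes "A \<in> carrier_mat n m" "B \<in> carrier_mat m k"
  shows "reduce_mat p (reduce_mat p A * B) = reduce_mat p (A * B)"
proof (intro eq_matI)
  fix i j assume "i < dim_row (reduce_mat p (A * B))" "j < dim_col (reduce_mat p (A * B))"
  with assms have ij: "i < n" "j < k" by (auto simp: reduce_mat_def)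
  have "[(\<Sum>l = 0..<m. (A $$ (i,l) mod int p) * B $$ (l,j)) = (\<Sum>l = 0..<m. A $$ (i,l) * B $$ (l,j))] (mod int p)"
    by (intro cong_sum cong_mult) (simp_all add: cong_def)
  then show "reduce_mat p (reduce_mat p A * B) $$ (i,j) = reduce_mat p (A * B) $$ (i,j)"
    using assms ij by (auto simp: reduce_mat_def scalar_prod_def cong_def)
qed (use assms in \<open>auto simp: reduce_mat_def\<close>)

lemma reduce_mat_mult_right:
  assumes "A \<in> carrier_mat n m" "B \<in> carrier_mat m k"
  shows "reduce_mat p (A * reduce_mat p B) = reduce_mat p (A * B)"
proof (intro eq_matI)
  fix i j assume "i < dim_row (reduce_mat p (A * B))" "j < dim_col (reduce_mat p (A * B))"
  with assms have ij: "i < n" "j < k" by (auto simp: reduce_mat_def)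
  have "[(\<Sum>l = 0..<m. A $$ (i,l) * (B $$ (l,j) mod int p)) = (\<Sum>l = 0..<m. A $$ (i,l) * B $$ (l,j))] (mod int p)"
    by (intro cong_sum cong_mult) (simp_all add: cong_def)
  then show "reduce_mat p (A * reduce_mat p B) $$ (i,j) = reduce_mat p (A * B) $$ (i,j)"
    using assms ij by (auto simp: reduce_mat_def scalar_prod_def cong_def)
qed (use assms in \<open>auto simp: reduce_mat_def\<close>)

lemma reduce_mat_one:
  assumes "prime p"
  shows "reduce_mat p (1\<^sub>m N) = 1\<^sub>m N"
  using prime_gt_1_nat[OF assms] by (intro eq_matI) (auto simp: reduce_mat_def)

lemma group_SL:
  assumes p: "prime p"
  shows "group (SL N p)"
proof (rule groupI)
  note iff = SL_carrier_iff[OF p]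
  have mult: "A \<otimes>\<^bsub>SL N p\<^esub> B = reduce_mat p (A * B)" for A B by (simp add: SL_def)
  have one: "\<one>\<^bsub>SL N p\<^esub> = 1\<^sub>m N" by (simp add: SL_def)
  show "\<one>\<^bsub>SL N p\<^esub> \<in> carrier (SL N p)"
    unfolding iff one using reduce_mat_one[OF p] by simp
  fix A assume A: "A \<in> carrier (SL N p)"
  then have Ac: "A \<in> carrier_mat N N" and Ar: "reduce_mat p A = A" and Ad: "[det A = 1] (mod int p)"
    by (auto simp: iff)
  show "\<one>\<^bsub>SL N p\<^esub> \<otimes>\<^bsub>SL N p\<^esub> A = A"
    unfolding mult one using Ac Ar by simp
  show "\<exists>B\<in>carrier (SL N p). B \<otimes>\<^bsub>SL N p\<^esub> A = \<one>\<^bsub>SL N p\<^esub>"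
  proof
    let ?B = "reduce_mat p (adj_mat A)"
    have adj: "adj_mat A \<in> carrier_mat N N" "adj_mat A * A = det A \<cdot>\<^sub>m 1\<^sub>m N"
      using adj_mat[OF Ac] by auto
    have "reduce_mat p (?B * A) = reduce_mat p (det A \<cdot>\<^sub>m 1\<^sub>m N)"
      using reduce_mat_mult_left[OF adj(1) Ac] adj(2) by simp
    also have "\<dots> = 1\<^sub>m N"
      using Ad prime_gt_1_nat[OF p] by (intro eq_matI) (auto simp: reduce_mat_def cong_def)
    finally have BA: "reduce_mat p (?B * A) = 1\<^sub>m N" .
    then show "?B \<otimes>\<^bsub>SL N p\<^esub> A = \<one>\<^bsub>SL N p\<^esub>" by (simp add: mult one)
    have Bc: "?B \<in> carrier_mat N N" using adj by simp
    have "[det ?B * det A = 1] (mod int p)"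
      using det_reduce_mat[of p "?B * A"] det_mult[OF Bc Ac] BA by (simp add: cong_sym)
    moreover have "[det ?B * det A = det ?B * 1] (mod int p)"
      using Ad by (intro cong_mult) auto
    ultimately have "[det ?B = 1] (mod int p)" by (metis cong_sym cong_trans mult.right_neutral)
    then show "?B \<in> carrier (SL N p)" unfolding iff using Bc by simp
  qed
  fix B assume "B \<in> carrier (SL N p)"
  then have Bc: "B \<in> carrier_mat N N" and Bd: "[det B = 1] (mod int p)"
    by (auto simp: iff)
  have "[det A * det B = 1 * 1] (mod int p)" using Ad Bd by (rule cong_mult)
  then have "[det (reduce_mat p (A * B)) = 1] (mod int p)"
    using det_reduce_mat[of p "A * B"] det_mult[OF Ac Bc] by (metis cong_trans mult_1)
  then show "A \<otimes>\<^bsub>SL N p\<^esub> B \<in> carrier (SL N p)"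
    unfolding iff mult using Ac Bc by auto
  fix D assume "D \<in> carrier (SL N p)"
  then have Dc: "D \<in> carrier_mat N N" by (auto simp: iff)
  show "(A \<otimes>\<^bsub>SL N p\<^esub> B) \<otimes>\<^bsub>SL N p\<^esub> D = A \<otimes>\<^bsub>SL N p\<^esub> (B \<otimes>\<^bsub>SL N p\<^esub> D)"
    unfolding mult
    using reduce_mat_mult_left[of "A * B" N N D N] reduce_mat_mult_right[of A N N "B * D" N] Ac Bc Dc
    by simp
qed

end

theory Submission
  imports Defs
begin

text \<open>Gaussian elimination writes every element of \<open>SL\<^sub>N(\<F>\<^sub>p)\<close> as a product of \<open>N (N + 2)\<close>
  transvections, so it suffices that every transvection is a word of length \<open>O(log p)\<close>. For distinct
  \<open>i, j, k\<close> the transvections \<open>e\<^sub>i\<^sub>k(u) e\<^sub>j\<^sub>k(v)\<close> form an abelian group of translations on which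
  \<open>A = e\<^sub>i\<^sub>j e\<^sub>j\<^sub>i\<close> acts by the hyperbolic matrix \<open>M = ((2,1),(1,1))\<close>. By Cayley-Hamilton
  \<open>M^r + M^(-r)\<close> is the scalar \<open>L = tr M^r\<close>, which grows exponentially in \<open>r\<close>, and expanding the
  parameter of a transvection in these numbers with bounded digits gives a short word by Horner's
  scheme.\<close>

section \<open>Word balls in groups\<close>

definition word_ball :: "('a, 'b) monoid_scheme \<Rightarrow> 'a set \<Rightarrow> nat \<Rightarrow> 'a set" where
  "word_ball G X d = {g. \<exists>w. length w \<le> d \<and> represents_elem G X w g}"

lemma cayley_diam_le:
  assumes "carrier G \<subseteq> word_ball G X d"
  shows "cayley_diam G X \<le> enat d"
  unfolding cayley_diam_def
  by (rule Inf_lower) (use assms in \<open>auto simp: word_ball_def\<close>)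

lemma word_ball_mono: "c \<le> d \<Longrightarrow> word_ball G X c \<subseteq> word_ball G X d"
  unfolding word_ball_def using le_trans by blast

context group
begin

lemma one_in_word_ball: "\<one> \<in> word_ball G X d"
  unfolding word_ball_def represents_elem_def by (auto intro!: exI[of _ "[]"])

lemma generator_in_word_ball:
  assumes "x \<in> X" "X \<subseteq> carrier G" "1 \<le> d"
  shows "x \<in> word_ball G X d"
  using assms unfolding word_ball_def represents_elem_def
  by (auto intro!: exI[of _ "[x]"])

lemma foldr_mult_closed:
  assumes "set w \<subseteq> carrier G"
  shows "foldr (\<otimes>) w \<one> \<in> carrier G"
  using assms by (induction w) auto

lemma foldr_mult_append:
  assumes "set v \<subseteq> carrier G" "set w \<subseteq> carrier G"
  shows "foldr (\<otimes>) (v @ w) \<one> = foldr (\<otimes>) v \<one> \<otimes> foldr (\<otimes>) w \<one>"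
  using assms
proof (induction v)
  case (Cons x v)
  then show ?case
    by (simp add: m_assoc foldr_mult_closed del: foldr_append)
qed (simp add: foldr_mult_closed)

lemma foldr_mult_inv:
  assumes "set w \<subseteq> carrier G"
  shows "foldr (\<otimes>) (map (m_inv G) (rev w)) \<one> = inv (foldr (\<otimes>) w \<one>)"
  using assms
proof (induction w)
  case (Cons x w)
  have "foldr (\<otimes>) (map (m_inv G) (rev w) @ [inv x]) \<one>
      = foldr (\<otimes>) (map (m_inv G) (rev w)) \<one> \<otimes> foldr (\<otimes>) [inv x] \<one>"
    using Cons.prems by (intro foldr_mult_append) auto
  then show ?case
    using Cons by (simp add: inv_mult_group foldr_mult_closed del: foldr_append)
qed simp

lemma letters_subset_carrier:
  assumes "X \<subseteq> carrier G" "set w \<subseteq> X \<union> m_inv G ` X"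
  shows "set w \<subseteq> carrier G"
  using assms inv_closed by blast

lemma word_ball_subset_carrier:
  assumes "X \<subseteq> carrier G"
  shows "word_ball G X d \<subseteq> carrier G"
  using letters_subset_carrier[OF assms] foldr_mult_closed
  unfolding word_ball_def represents_elem_def by blast

lemma mult_in_word_ball:
  assumes X: "X \<subseteq> carrier G" and g: "g \<in> word_ball G X c" and h: "h \<in> word_ball G X d"
  shows "g \<otimes> h \<in> word_ball G X (c + d)"
proof -
  obtain v where v: "length v \<le> c" "set v \<subseteq> X \<union> m_inv G ` X" "foldr (\<otimes>) v \<one> = g"
    using g by (auto simp: word_ball_def represents_elem_def)
  obtain w where w: "length w \<le> d" "set w \<subseteq> X \<union> m_inv G ` X" "foldr (\<otimes>) w \<one> = h"
    using h by (auto simp: word_ball_def represents_elem_def)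
  have "foldr (\<otimes>) (v @ w) \<one> = g \<otimes> h"
    using foldr_mult_append[OF letters_subset_carrier[OF X v(2)] letters_subset_carrier[OF X w(2)]]
      v(3) w(3) by simp
  then show ?thesis
    using v w unfolding word_ball_def represents_elem_def
    by (intro CollectI exI[of _ "v @ w"]) (simp del: foldr_append)
qed

lemma inv_in_word_ball:
  assumes X: "X \<subseteq> carrier G" and g: "g \<in> word_ball G X d"
  shows "inv g \<in> word_ball G X d"
proof -
  obtain w where w: "length w \<le> d" "set w \<subseteq> X \<union> m_inv G ` X" "foldr (\<otimes>) w \<one> = g"
    using g by (auto simp: word_ball_def represents_elem_def)
  have "inv y \<in> X \<union> m_inv G ` X" if "y \<in> set w" for y
    using that w(2) X inv_inv by fastforce
  then have "set (map (m_inv G) (rev w)) \<subseteq> X \<union> m_inv G ` X" by auto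
  then show ?thesis
    using foldr_mult_inv[OF letters_subset_carrier[OF X w(2)]] w(1,3)
    unfolding word_ball_def represents_elem_def
    by (intro CollectI exI[of _ "map (m_inv G) (rev w)"]) simp
qed

lemma pow_in_word_ball:
  assumes X: "X \<subseteq> carrier G" and g: "g \<in> word_ball G X d"
  shows "g [^] (n::nat) \<in> word_ball G X (n * d)"
proof (induction n)
  case (Suc n)
  then show ?case using mult_in_word_ball[OF X Suc g] by (simp add: add.commute)
qed (simp add: one_in_word_ball)

text \<open>Each letter is replaced by a word of length at most \<open>c\<close>; inverse letters
  cost no more, because balls are closed under inversion. This lets a bound on the number of
  transvections be multiplied by a bound on the length of one transvection.\<close>

lemma word_ball_trans:
  assumes X: "X \<subseteq> carrier G" and S: "S \<subseteq> word_ball G X c"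
  shows "word_ball G S d \<subseteq> word_ball G X (d * c)"
proof -
  have "foldr (\<otimes>) w \<one> \<in> word_ball G X (length w * c)" if "set w \<subseteq> S \<union> m_inv G ` S" for w
    using that
  proof (induction w)
    case (Cons x w)
    have "x \<in> word_ball G X c"
      using Cons.prems S inv_in_word_ball[OF X] by auto
    then show ?case using mult_in_word_ball[OF X] Cons by simp
  qed (simp add: one_in_word_ball)
  moreover have "word_ball G X (length w * c) \<subseteq> word_ball G X (d * c)" if "length w \<le> d" for w :: "'a list"
    using that by (intro word_ball_mono mult_le_mono1)
  ultimately show ?thesis
    by (auto simp: word_ball_def[of G S] represents_elem_def)
qed

end

section \<open>Logarithmic length of translations\<close>

text \<open>The vectors \<open>(lucas_x k, lucas_y k)\<close> and \<open>(lucas_x k - lucas_y k, - lucas_y k)\<close> are \<open>M^k (1,0)\<close>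
  and \<open>M^(-k) (1,0)\<close> for the matrix \<open>M = ((2,1),(1,1))\<close>; as the trace of \<open>M^k\<close> is
  \<open>2 * lucas_x k - lucas_y k\<close>, their sum is that multiple of \<open>(1,0)\<close>.\<close>

fun lucas_x :: "nat \<Rightarrow> int" and lucas_y :: "nat \<Rightarrow> int" where
  "lucas_x 0 = 1"
| "lucas_y 0 = 0"
| "lucas_x (Suc k) = 2 * lucas_x k + lucas_y k"
| "lucas_y (Suc k) = lucas_x k + lucas_y k"

text \<open>The Lucas number of index \<open>2 * k\<close>: 2, 3, 7, 18, ...\<close>

definition lucas_even :: "nat \<Rightarrow> int" where
  "lucas_even k = 2 * lucas_x k - lucas_y k"

text \<open>The ratio bound \<open>4 * lucas_y k \<le> 3 * lucas_x k\<close> says exactly that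
  \<open>lucas_even\<close> grows by a factor of at most 3 from \<open>k\<close> to
  \<open>Suc k\<close>, so that greedy digits are at most 2. The power of two makes the number of
  digits logarithmic.\<close>

lemma lucas_bounds: "0 \<le> lucas_y k \<and> 4 * lucas_y k \<le> 3 * lucas_x k \<and> 2 ^ k \<le> lucas_x k"
  by (induction k) auto

lemma lucas_even_pos: "0 < lucas_even k"
proof -
  have "(0::int) < 2 ^ k" by simp
  then show ?thesis using lucas_bounds[of k] unfolding lucas_even_def by linarith
qed

lemma lucas_even_Suc_le: "lucas_even (Suc k) \<le> 3 * lucas_even k"
  using lucas_bounds[of k] by (simp add: lucas_even_def)

lemma lucas_even_Suc_ge: "2 ^ k \<le> lucas_even (Suc k)"
proof -
  have "(0::int) < 2 ^ k" by simp
  then show ?thesis using lucas_bounds[of k] by (simp add: lucas_even_def)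
qed

text \<open>\<open>T\<close> is a homomorphism from Z^2, and conjugation by \<open>a\<close> and
  \<open>b\<close> acts on it as the two elementary shears of SL_2(Z). The parameters are integers
  rather than residues, so that digit expansions make sense.\<close>

locale translation_action = group G for G (structure) +
  fixes X :: "'a set" and a b :: 'a and T :: "int \<Rightarrow> int \<Rightarrow> 'a"
  assumes X_carrier: "X \<subseteq> carrier G"
    and a_in: "a \<in> X" and b_in: "b \<in> X" and T10_in: "T 1 0 \<in> X"
    and T_closed [simp]: "T u v \<in> carrier G"
    and T_add: "T u v \<otimes> T u' v' = T (u + u') (v + v')"
    and a_T: "a \<otimes> T u v = T (u + v) v \<otimes> a"
    and b_T: "b \<otimes> T u v = T u (u + v) \<otimes> b"
begin

lemma ab_closed [simp]: "a \<in> carrier G" "b \<in> carrier G"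
  using X_carrier a_in b_in by auto

lemma T_zero: "T 0 0 = \<one>"
  using T_add[of 0 0 0 0] l_cancel_one[of "T 0 0" "T 0 0"] by simp

section \<open>The hyperbolic element and its action on translations\<close>

definition A :: 'a where "A = a \<otimes> b"

lemma A_closed [simp]: "A \<in> carrier G"
  by (simp add: A_def)

lemma A_T: "A \<otimes> T u v = T (2 * u + v) (u + v) \<otimes> A"
proof -
  have "A \<otimes> T u v = a \<otimes> (b \<otimes> T u v)" by (simp add: A_def m_assoc)
  also have "\<dots> = (a \<otimes> T u (u + v)) \<otimes> b" by (simp add: b_T m_assoc)
  also have "\<dots> = T (2 * u + v) (u + v) \<otimes> A"
    by (simp add: a_T A_def m_assoc algebra_simps)
  finally show ?thesis .
qed

text \<open>The coefficients are those of \<open>M^(-1) = ((1,-1),(-1,2))\<close>.\<close>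

lemma inv_A_T: "inv A \<otimes> T u v = T (u - v) (2 * v - u) \<otimes> inv A"
proof -
  have "A \<otimes> (T (u - v) (2 * v - u) \<otimes> inv A) = (A \<otimes> T (u - v) (2 * v - u)) \<otimes> inv A"
    by (simp add: m_assoc)
  also have "\<dots> = T u v" by (simp add: A_T m_assoc)
  finally show ?thesis by (simp add: inv_solve_left')
qed

lemma pow_A_T: "A [^] (k::nat) \<otimes> T d 0 = T (d * lucas_x k) (d * lucas_y k) \<otimes> A [^] k"
proof (induction k)
  case (Suc k)
  have "A [^] Suc k \<otimes> T d 0 = A \<otimes> (A [^] k \<otimes> T d 0)"
    using nat_pow_Suc2[OF A_closed] by (simp add: m_assoc del: nat_pow_Suc)
  also have "\<dots> = (A \<otimes> T (d * lucas_x k) (d * lucas_y k)) \<otimes> A [^] k"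
    by (simp add: Suc m_assoc)
  also have "\<dots> = T (d * lucas_x (Suc k)) (d * lucas_y (Suc k)) \<otimes> A [^] Suc k"
    using nat_pow_Suc2[OF A_closed] by (simp add: A_T m_assoc algebra_simps del: nat_pow_Suc)
  finally show ?case .
qed simp

lemma pow_inv_A_T:
  "inv A [^] (k::nat) \<otimes> T d 0 = T (d * (lucas_x k - lucas_y k)) (- (d * lucas_y k)) \<otimes> inv A [^] k"
proof (induction k)
  case (Suc k)
  let ?u = "d * (lucas_x k - lucas_y k)" and ?v = "- (d * lucas_y k)"
  have "inv A [^] Suc k \<otimes> T d 0 = inv A \<otimes> (inv A [^] k \<otimes> T d 0)"
    using nat_pow_Suc2[OF inv_closed[OF A_closed]] by (simp add: m_assoc del: nat_pow_Suc)
  also have "\<dots> = (inv A \<otimes> T ?u ?v) \<otimes> inv A [^] k"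
    by (simp add: Suc m_assoc)
  also have "\<dots> = T (?u - ?v) (2 * ?v - ?u) \<otimes> inv A [^] Suc k"
    using nat_pow_Suc2[OF inv_closed[OF A_closed]]
    by (simp add: inv_A_T m_assoc del: nat_pow_Suc)
  also have "T (?u - ?v) (2 * ?v - ?u)
      = T (d * (lucas_x (Suc k) - lucas_y (Suc k))) (- (d * lucas_y (Suc k)))"
    by (rule arg_cong2[of _ _ _ _ T]) (simp_all add: algebra_simps)
  finally show ?case .
qed simp

lemma A_in_word_ball: "A \<in> word_ball G X 2"
  unfolding A_def one_add_one[symmetric]
  by (intro mult_in_word_ball generator_in_word_ball X_carrier a_in b_in order.refl)

lemma T_digit_in_word_ball:
  assumes "0 \<le> d" "d \<le> 2"
  shows "T d 0 \<in> word_ball G X 2"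
proof -
  have "T 1 0 \<otimes> T 1 0 \<in> word_ball G X (1 + 1)"
    by (intro mult_in_word_ball generator_in_word_ball X_carrier T10_in order.refl)
  then have "T 2 0 \<in> word_ball G X 2" by (simp only: T_add one_add_one add_0)
  moreover have "T 1 0 \<in> word_ball G X 2" "T 0 0 \<in> word_ball G X 2"
    using generator_in_word_ball[OF T10_in X_carrier] one_in_word_ball by (auto simp: T_zero)
  moreover have "d = 0 \<or> d = 1 \<or> d = 2" using assms by auto
  ultimately show ?thesis by auto
qed

text \<open>Horner's scheme for the greedy expansion of \<open>n\<close> in the numbers \<open>lucas_even k\<close>, whose digits
  are at most 2: leaving the powers of \<open>A\<close> uncancelled at the end lets the next digit be appended.\<close>

lemma horner_in_word_ball:
  assumes "0 \<le> n" "n < lucas_even (Suc k)"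
  shows "\<exists>u v u' v'. u + u' = n \<and> v + v' = 0 \<and>
    T u v \<otimes> A [^] k \<in> word_ball G X (4 * k + 2) \<and> T u' v' \<otimes> inv A [^] k \<in> word_ball G X (4 * k + 2)"
  using assms
proof (induction k arbitrary: n)
  \<comment> \<open>\<open>lucas_even (Suc 0) = 3\<close>, so \<open>n\<close> is itself a digit 0,
    1 or 2; it goes entirely into the first word.\<close>
  case 0
  then have "T n 0 \<in> word_ball G X 2"
    by (intro T_digit_in_word_ball) (auto simp: lucas_even_def)
  then show ?case
    by - (rule exI[of _ n], rule exI[of _ 0], rule exI[of _ 0], rule exI[of _ 0],
      simp add: one_in_word_ball T_zero numeral_2_eq_2)
next
  case (Suc k)
  define L where "L = lucas_even (Suc k)"
  \<comment> \<open>The leading digit: \<open>n\<close> is below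
    \<open>lucas_even (Suc (Suc k))\<close>, hence below \<open>3 * L\<close>, which gives
    \<open>d \<le> 2\<close>.\<close>
  define d where "d = n div L"
  have L: "0 < L" and L3: "n < 3 * L"
    using lucas_even_pos lucas_even_Suc_le[of "Suc k"] Suc.prems by (auto simp: L_def)
  have d: "0 \<le> d" "d \<le> 2"
  proof -
    show "0 \<le> d" using Suc.prems L by (simp add: d_def pos_imp_zdiv_nonneg_iff)
    have "d * L \<le> n" using L minus_mod_eq_div_mult[of n L] pos_mod_sign[of L n] unfolding d_def by linarith
    then have "d * L < 3 * L" using L3 by linarith
    then show "d \<le> 2" using L by simp
  qed
  have "0 \<le> n mod L" "n mod L < L" using L by auto
  then obtain u v u' v' where uv: "u + u' = n mod L" "v + v' = 0"
    and g: "T u v \<otimes> A [^] k \<in> word_ball G X (4 * k + 2)"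
    and h: "T u' v' \<otimes> inv A [^] k \<in> word_ball G X (4 * k + 2)"
    using Suc.IH unfolding L_def by blast
  let ?k = "Suc k"
  \<comment> \<open>One Horner step for \<open>C = A\<close> and \<open>C = inv A\<close> alike: two
    letters for \<open>C\<close> and two for the digit account for the 4 in the length bound. Moving
    \<open>T d 0\<close> to the left past the \<open>Suc k\<close> factors \<open>C\<close>
    multiplies its vector by the corresponding power of \<open>M\<close>.\<close>
  have step: "x \<otimes> C [^] k \<otimes> (C \<otimes> T d 0) \<in> word_ball G X (4 * ?k + 2)"
    if "x \<otimes> C [^] k \<in> word_ball G X (4 * k + 2)" "C \<in> word_ball G X 2" for x C
    using mult_in_word_ball[OF X_carrier that(1) mult_in_word_ball[OF X_carrier that(2) T_digit_in_word_ball[OF d]]]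
    by (simp add: ac_simps)
  have "T u v \<otimes> A [^] k \<otimes> (A \<otimes> T d 0) = T u v \<otimes> (A [^] ?k \<otimes> T d 0)"
    by (simp add: m_assoc)
  also have "\<dots> = T (u + d * lucas_x ?k) (v + d * lucas_y ?k) \<otimes> A [^] ?k"
    by (simp only: pow_A_T T_add[symmetric]) (simp add: m_assoc)
  finally have g': "T (u + d * lucas_x ?k) (v + d * lucas_y ?k) \<otimes> A [^] ?k \<in> word_ball G X (4 * ?k + 2)"
    using step[OF g A_in_word_ball] by simp
  have "T u' v' \<otimes> inv A [^] k \<otimes> (inv A \<otimes> T d 0) = T u' v' \<otimes> (inv A [^] ?k \<otimes> T d 0)"
    by (simp add: m_assoc)
  also have "\<dots> = T (u' + d * (lucas_x ?k - lucas_y ?k)) (v' + - (d * lucas_y ?k)) \<otimes> inv A [^] ?k"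
    by (simp only: pow_inv_A_T T_add[symmetric]) (simp add: m_assoc)
  finally have h': "T (u' + d * (lucas_x ?k - lucas_y ?k)) (v' + - (d * lucas_y ?k)) \<otimes> inv A [^] ?k
      \<in> word_ball G X (4 * ?k + 2)"
    using step[OF h inv_in_word_ball[OF X_carrier A_in_word_ball]] by simp
  \<comment> \<open>The two words together gain \<open>d\<close> times
    \<open>(M^r + M^(-r)) (1,0) = (L,0)\<close> with \<open>r = Suc k\<close>.\<close>
  have "(u + d * lucas_x ?k) + (u' + d * (lucas_x ?k - lucas_y ?k)) = n mod L + d * L"
    using uv by (simp add: L_def lucas_even_def algebra_simps)
  then have "(u + d * lucas_x ?k) + (u' + d * (lucas_x ?k - lucas_y ?k)) = n"
    by (simp add: d_def)
  moreover have "(v + d * lucas_y ?k) + (v' + - (d * lucas_y ?k)) = 0" using uv by simp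
  ultimately show ?case using g' h' by blast
qed

text \<open>Cancelling the trailing power of \<open>A\<close> or \<open>inv A\<close> costs
  \<open>2 * k\<close> letters for each of the two Horner words; their product is then the
  translation, of length \<open>2 * ((4 * k + 2) + 2 * k)\<close>.\<close>

lemma T_in_word_ball:
  assumes "0 \<le> n" "n < 2 ^ k"
  shows "T n 0 \<in> word_ball G X (12 * k + 4)"
proof -
  have "n < lucas_even (Suc k)" using assms lucas_even_Suc_ge[of k] by simp
  then obtain u v u' v' where uv: "u + u' = n" "v + v' = 0"
    and g: "T u v \<otimes> A [^] k \<in> word_ball G X (4 * k + 2)"
    and h: "T u' v' \<otimes> inv A [^] k \<in> word_ball G X (4 * k + 2)"
    using horner_in_word_ball[OF assms(1)] by blast
  have pow: "inv A [^] k \<in> word_ball G X (k * 2)" "A [^] k \<in> word_ball G X (k * 2)"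
    using pow_in_word_ball[OF X_carrier] inv_in_word_ball[OF X_carrier] A_in_word_ball by blast+
  have inv: "A [^] k \<otimes> inv A [^] k = \<one>" "inv A [^] k \<otimes> A [^] k = \<one>"
    by (simp_all add: nat_pow_inv)
  have "T n 0 = T u v \<otimes> T u' v'" using uv by (simp add: T_add)
  also have "\<dots> = (T u v \<otimes> A [^] k \<otimes> inv A [^] k) \<otimes> (T u' v' \<otimes> inv A [^] k \<otimes> A [^] k)"
    using inv by (simp add: m_assoc)
  also have "\<dots> \<in> word_ball G X ((4 * k + 2 + k * 2) + (4 * k + 2 + k * 2))"
    by (intro mult_in_word_ball[OF X_carrier] g h pow)
  also have "(4 * k + 2 + k * 2) + (4 * k + 2 + k * 2) = 12 * k + 4" by simp
  finally show ?thesis .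
qed

end

section \<open>Transvections modulo \<open>p\<close>\<close>

definition transvection :: "nat \<Rightarrow> nat \<Rightarrow> int \<Rightarrow> nat \<Rightarrow> nat \<Rightarrow> int mat" where
  "transvection N p t i j = reduce_mat p (addrow_mat N t i j)"

lemma mult_SL: "A \<otimes>\<^bsub>SL N p\<^esub> B = reduce_mat p (A * B)"
  by (simp add: SL_def)

lemma one_SL: "\<one>\<^bsub>SL N p\<^esub> = 1\<^sub>m N"
  by (simp add: SL_def)

lemma transvection_in_SL:
  assumes "prime p" "i \<noteq> j"
  shows "transvection N p t i j \<in> carrier (SL N p)"
  using det_reduce_mat[of p "addrow_mat N t i j"] det_addrow_mat[OF assms(2), of N t]
  unfolding SL_carrier_iff[OF assms(1)] transvection_def by simp

lemma transvection_mod: "transvection N p (t mod int p) i j = transvection N p t i j"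
  unfolding transvection_def by (intro eq_matI) (auto simp: reduce_mat_def mod_simps)

lemma elementary_mat_eq_transvection:
  assumes "prime p" "i \<noteq> j"
  shows "elementary_mat N i j = transvection N p 1 i j"
  using assms prime_gt_1_nat[OF assms(1)] unfolding transvection_def elementary_mat_def
  by (intro eq_matI) (auto simp: reduce_mat_def)

lemma reduce_mat_mult_both:
  assumes "A \<in> carrier_mat N N" "B \<in> carrier_mat N N"
  shows "reduce_mat p A \<otimes>\<^bsub>SL N p\<^esub> reduce_mat p B = reduce_mat p (A * B)"
  using assms reduce_mat_mult_left[of A N N "reduce_mat p B" N p] reduce_mat_mult_right[of A N N B N p]
  by (simp add: mult_SL)

text \<open>The last two relations rest on the Steinberg relation that the commutator of
  \<open>e_ij\<close> and \<open>e_jk(v)\<close> is \<open>e_ik(v)\<close>, and its analogue with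
  \<open>i\<close> and \<open>j\<close> swapped. All are checked over the integers: left factors
  become row operations, which leaves an entrywise comparison without sums.\<close>

lemma addrow_mat_commutes:
  assumes "i < N" "j < N" "k < N" "i \<noteq> j" "i \<noteq> k" "j \<noteq> k"
  defines "V \<equiv> \<lambda>u v. addrow_mat N u i k * addrow_mat N v j k"
  shows "V u v * V u' v' = V (u + u') (v + v')"
    and "addrow_mat N 1 i j * V u v = V (u + v) v * addrow_mat N 1 i j"
    and "addrow_mat N 1 j i * V u v = V u (u + v) * addrow_mat N 1 j i"
proof -
  have V: "V u v = addrow u i k (addrow_mat N v j k)" for u v
    unfolding V_def using assms by (subst addrow_mat[symmetric]) auto
  have Vm: "V u v * B = addrow u i k (addrow v j k B)" if "B \<in> carrier_mat N N" for u v B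
  proof -
    have "V u v * B = addrow_mat N u i k * (addrow_mat N v j k * B)"
      unfolding V_def using that by (intro assoc_mult_mat) auto
    also have "\<dots> = addrow u i k (addrow v j k B)"
      using assms(3) addrow_mat[OF that assms(3)]
        addrow_mat[OF mult_carrier_mat[OF addrow_mat_carrier that] assms(3)] by simp
    finally show ?thesis .
  qed
  have Vc: "V u v \<in> carrier_mat N N" for u v
    unfolding V_def by (rule mult_carrier_mat[OF addrow_mat_carrier addrow_mat_carrier])
  show "V u v * V u' v' = V (u + u') (v + v')"
    unfolding Vm[OF Vc] unfolding V using assms(1-6)
    by (intro eq_matI) (auto simp: algebra_simps)
  have "addrow_mat N 1 i j * V u v = addrow 1 i j (V u v)"
    using addrow_mat[OF Vc] assms by simp
  also have "\<dots> = V (u + v) v * addrow_mat N 1 i j"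
    unfolding Vm[OF addrow_mat_carrier] unfolding V using assms(1-6)
    by (intro eq_matI) (auto simp: algebra_simps)
  finally show "addrow_mat N 1 i j * V u v = V (u + v) v * addrow_mat N 1 i j" .
  have "addrow_mat N 1 j i * V u v = addrow 1 j i (V u v)"
    using addrow_mat[OF Vc] assms by simp
  also have "\<dots> = V u (u + v) * addrow_mat N 1 j i"
    unfolding Vm[OF addrow_mat_carrier] unfolding V using assms(1-6)
    by (intro eq_matI) (auto simp: algebra_simps)
  finally show "addrow_mat N 1 j i * V u v = V u (u + v) * addrow_mat N 1 j i" .
qed

lemma transvection_in_word_ball:
  assumes p: "prime p" and N: "N \<ge> 3" and ik: "i < N" "k < N" "i \<noteq> k" and m: "p \<le> 2 ^ m"
  shows "transvection N p t i k
    \<in> word_ball (SL N p) {elementary_mat N i j | i j. i < N \<and> j < N \<and> i \<noteq> j} (12 * m + 4)"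
proof -
  let ?X = "{elementary_mat N i j | i j. i < N \<and> j < N \<and> i \<noteq> j}"
  \<comment> \<open>A third index \<open>j\<close> exists because \<open>N \<ge> 3\<close>; it
    supplies the second coordinate of the translations.\<close>
  have "\<not> {..<N} \<subseteq> {i, k}"
    using card_mono[of "{i, k}" "{..<N}"] N ik by auto
  then obtain j where j: "j < N" "i \<noteq> j" "j \<noteq> k" by blast
  define T where "T = (\<lambda>u v. transvection N p u i k \<otimes>\<^bsub>SL N p\<^esub> transvection N p v j k)"
  have T: "T u v = reduce_mat p (addrow_mat N u i k * addrow_mat N v j k)" for u v
    unfolding T_def transvection_def by (rule reduce_mat_mult_both) auto
  have T0: "T u 0 = transvection N p u i k" for u
  proof -
    have "addrow_mat N 0 j k = (1\<^sub>m N :: int mat)" by (intro eq_matI) auto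
    then show ?thesis by (simp add: T transvection_def right_mult_one_mat[OF addrow_mat_carrier])
  qed
  note rel = addrow_mat_commutes[OF ik(1) j(1) ik(2) j(2) ik(3) j(3)]
  have XE: "transvection N p 1 i' j' \<in> ?X" if "i' < N" "j' < N" "i' \<noteq> j'" for i' j'
    using that elementary_mat_eq_transvection[OF p that(3), symmetric] by auto
  interpret group "SL N p" by (rule group_SL[OF p])
  interpret translation_action "SL N p" ?X "transvection N p 1 i j" "transvection N p 1 j i" T
  proof
    show "?X \<subseteq> carrier (SL N p)"
      using elementary_mat_eq_transvection[OF p] transvection_in_SL[OF p] by auto
    show "transvection N p 1 i j \<in> ?X" "transvection N p 1 j i \<in> ?X" "T 1 0 \<in> ?X"
      unfolding T0 by (intro XE ik j ik(3)[symmetric] j(2)[symmetric])+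
    show "T u v \<in> carrier (SL N p)" for u v
      unfolding T_def using ik j by (intro m_closed transvection_in_SL[OF p]) auto
    show "T u v \<otimes>\<^bsub>SL N p\<^esub> T u' v' = T (u + u') (v + v')" for u v u' v'
      unfolding T by (simp add: reduce_mat_mult_both mult_carrier_mat[of _ N N] rel)
    show "transvection N p 1 i j \<otimes>\<^bsub>SL N p\<^esub> T u v = T (u + v) v \<otimes>\<^bsub>SL N p\<^esub> transvection N p 1 i j" for u v
      unfolding T transvection_def by (simp add: reduce_mat_mult_both mult_carrier_mat[of _ N N] rel)
    show "transvection N p 1 j i \<otimes>\<^bsub>SL N p\<^esub> T u v = T u (u + v) \<otimes>\<^bsub>SL N p\<^esub> transvection N p 1 j i" for u v
      unfolding T transvection_def by (simp add: reduce_mat_mult_both mult_carrier_mat[of _ N N] rel)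
  qed
  have p0: "0 < int p" using prime_gt_0_nat[OF p] by simp
  have "int p \<le> 2 ^ m" using m by (metis of_nat_le_iff of_nat_numeral of_nat_power)
  \<comment> \<open>The integer expansion is applied to the representative of \<open>t\<close> in
    \<open>{0..p-1}\<close>, which defines the same transvection.\<close>
  then have "t mod int p < 2 ^ m" using pos_mod_bound[OF p0, of t] by linarith
  then have "T (t mod int p) 0 \<in> word_ball (SL N p) ?X (12 * m + 4)"
    using p0 by (intro T_in_word_ball) auto
  then show ?thesis by (simp add: T0 transvection_mod)
qed

section \<open>Gaussian elimination\<close>

lemma SL_index_mod:
  assumes "prime p" "A \<in> carrier (SL N p)" "i < N" "j < N"
  shows "A $$ (i, j) mod int p = A $$ (i, j)"
proof -
  have "A \<in> carrier_mat N N" "reduce_mat p A = A" using assms SL_carrier_iff by auto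
  then have "A $$ (i, j) = reduce_mat p A $$ (i, j)" by simp
  also have "\<dots> = A $$ (i, j) mod int p"
    using assms \<open>A \<in> carrier_mat N N\<close> by (simp add: reduce_mat_def)
  finally show ?thesis by simp
qed

lemma transvection_mult_index:
  assumes p: "prime p" and A: "A \<in> carrier (SL N p)" and "r < N" "s < N" "i < N" "j < N"
  shows "(transvection N p t r s \<otimes>\<^bsub>SL N p\<^esub> A) $$ (i, j)
    = (if i = r then (A $$ (r, j) + t * A $$ (s, j)) mod int p else A $$ (i, j))"
proof -
  have Ac: "A \<in> carrier_mat N N" using A SL_carrier_iff[OF p] by auto
  have "transvection N p t r s \<otimes>\<^bsub>SL N p\<^esub> A = reduce_mat p (addrow t r s A)"
    unfolding mult_SL transvection_def
    using reduce_mat_mult_left[OF addrow_mat_carrier Ac] addrow_mat[OF Ac assms(4)] by simp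
  then show ?thesis
    using Ac assms SL_index_mod[OF p A, of i j] by (auto simp: reduce_mat_def add.commute)
qed

section \<open>Row reduction as left multiplication by transvections\<close>

definition transvections :: "nat \<Rightarrow> nat \<Rightarrow> int mat set" where
  "transvections N p = {transvection N p t r s | t r s. r < N \<and> s < N \<and> r \<noteq> s}"

definition unit_columns :: "nat \<Rightarrow> nat \<Rightarrow> int mat \<Rightarrow> bool" where
  "unit_columns N k A \<longleftrightarrow> (\<forall>i<N. \<forall>j<k. A $$ (i, j) = (if i = j then 1 else 0))"

text \<open>The cost \<open>d\<close> counts row operations, that is transvections with arbitrary
  parameter, not elementary generators.\<close>

definition reaches :: "nat \<Rightarrow> nat \<Rightarrow> nat \<Rightarrow> int mat \<Rightarrow> int mat \<Rightarrow> bool" where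
  "reaches N p d A B \<longleftrightarrow> (\<exists>g \<in> word_ball (SL N p) (transvections N p) d. g \<otimes>\<^bsub>SL N p\<^esub> A = B)"

context
  fixes N p :: nat
  assumes p: "prime p"
begin

interpretation group "SL N p"
  by (rule group_SL[OF p])

lemma transvections_subset: "transvections N p \<subseteq> carrier (SL N p)"
  unfolding transvections_def using transvection_in_SL[OF p] by auto

lemma reaches_refl: "A \<in> carrier (SL N p) \<Longrightarrow> reaches N p d A A"
  unfolding reaches_def using one_in_word_ball l_one by blast

lemma reaches_trans:
  assumes "A \<in> carrier (SL N p)" "reaches N p c A B" "reaches N p d B D"
  shows "reaches N p (c + d) A D"
proof -
  obtain g h where g: "g \<in> word_ball (SL N p) (transvections N p) c" "g \<otimes>\<^bsub>SL N p\<^esub> A = B"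
    and h: "h \<in> word_ball (SL N p) (transvections N p) d" "h \<otimes>\<^bsub>SL N p\<^esub> B = D"
    using assms unfolding reaches_def by blast
  have "h \<otimes>\<^bsub>SL N p\<^esub> g \<in> word_ball (SL N p) (transvections N p) (c + d)"
    using mult_in_word_ball[OF transvections_subset h(1) g(1)] by (simp add: add.commute)
  moreover have "h \<otimes>\<^bsub>SL N p\<^esub> g \<otimes>\<^bsub>SL N p\<^esub> A = D"
    using g h assms(1) word_ball_subset_carrier[OF transvections_subset] m_assoc by blast
  ultimately show ?thesis unfolding reaches_def by blast
qed

lemma transvection_mult_closed:
  assumes "A \<in> carrier (SL N p)" "r \<noteq> s"
  shows "transvection N p t r s \<otimes>\<^bsub>SL N p\<^esub> A \<in> carrier (SL N p)"
  using transvection_in_SL[OF p assms(2)] assms(1) by simp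

lemma reaches_transvection_mult:
  assumes "r < N" "s < N" "r \<noteq> s"
  shows "reaches N p 1 A (transvection N p t r s \<otimes>\<^bsub>SL N p\<^esub> A)"
proof -
  have "transvection N p t r s \<in> transvections N p" using assms by (auto simp: transvections_def)
  then have "transvection N p t r s \<in> word_ball (SL N p) (transvections N p) 1"
    by (rule generator_in_word_ball) (use transvections_subset in auto)
  then show ?thesis unfolding reaches_def by blast
qed

text \<open>Row \<open>s\<close> vanishes in the first \<open>k\<close> columns because
  \<open>k \<le> s\<close>, so adding a multiple of it to any row leaves these columns
  alone.\<close>

lemma unit_columns_transvection_mult:
  assumes A: "A \<in> carrier (SL N p)" and u: "unit_columns N k A"
    and "r < N" "s < N" "k \<le> s"
  shows "unit_columns N k (transvection N p t r s \<otimes>\<^bsub>SL N p\<^esub> A)"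
  unfolding unit_columns_def
proof (intro allI impI)
  fix i j assume ij: "i < N" "j < k"
  then have "A $$ (s, j) = 0" "j < N" using assms by (auto simp: unit_columns_def)
  then have "(transvection N p t r s \<otimes>\<^bsub>SL N p\<^esub> A) $$ (i, j) = A $$ (i, j)"
    using transvection_mult_index[OF p A assms(3,4) ij(1), of j] SL_index_mod[OF p A, of i j] ij
    by auto
  then show "(transvection N p t r s \<otimes>\<^bsub>SL N p\<^esub> A) $$ (i, j) = (if i = j then 1 else 0)"
    using ij u by (auto simp: unit_columns_def)
qed

text \<open>Multiplying \<open>A\<close> by its inverse \<open>B\<close> shows that the first \<open>k\<close> columns of \<open>B\<close> are unit columns too,
  so that a zero column below row \<open>k\<close> would make the diagonal entry \<open>k\<close> of \<open>B A\<close> vanish.\<close>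

lemma exists_pivot:
  assumes A: "A \<in> carrier (SL N p)" and u: "unit_columns N k A" and k: "k < N"
  shows "\<exists>l. k \<le> l \<and> l < N \<and> A $$ (l, k) \<noteq> 0"
proof (rule ccontr)
  assume "\<not> ?thesis"
  then have z: "A $$ (l, k) = 0" if "k \<le> l" "l < N" for l using that by blast
  define B where "B = inv\<^bsub>SL N p\<^esub> A"
  have B: "B \<in> carrier (SL N p)" using A by (simp add: B_def)
  have c: "A \<in> carrier_mat N N" "B \<in> carrier_mat N N" using A B SL_carrier_iff[OF p] by auto
  have "reduce_mat p (B * A) = 1\<^sub>m N"
    using A l_inv[OF A] by (simp add: B_def mult_SL one_SL)
  then have BA: "reduce_mat p (B * A) $$ (i, j) = (1\<^sub>m N :: int mat) $$ (i, j)" for i j by simp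
  have e: "(\<Sum>l = 0..<N. B $$ (i, l) * A $$ (l, j)) mod int p = (if i = j then 1 else 0)"
    if "i < N" "j < N" for i j
    using BA[of i j] c that by (simp add: reduce_mat_def scalar_prod_def)
  have Bk: "B $$ (k, j) = 0" if "j < k" for j
  proof -
    have "(\<Sum>l = 0..<N. B $$ (k, l) * A $$ (l, j)) = (\<Sum>l = 0..<N. if l = j then B $$ (k, l) else 0)"
      using u that by (intro sum.cong) (auto simp: unit_columns_def)
    also have "\<dots> = B $$ (k, j)" using that k by simp
    finally show ?thesis using e[of k j] that k SL_index_mod[OF p B, of k j] by simp
  qed
  have "(\<Sum>l = 0..<N. B $$ (k, l) * A $$ (l, k)) = 0"
    using Bk z by (intro sum.neutral) (metis atLeastLessThan_iff mult_eq_0_iff not_le)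
  then show False using e[of k k] k by simp
qed

text \<open>The last column has no row below its pivot to work with. Here \<open>A\<close> is upper
  triangular with all earlier diagonal entries 1, so its determinant is the last pivot.\<close>

lemma unit_last_pivot:
  assumes A: "A \<in> carrier (SL N p)" and u: "unit_columns N k A" and k: "Suc k = N"
  shows "A $$ (k, k) = 1"
proof -
  have c: "A \<in> carrier_mat N N" and d: "[det A = 1] (mod int p)"
    using A SL_carrier_iff[OF p] by auto
  have "upper_triangular A"
    using u c k by (intro upper_triangularI) (auto simp: unit_columns_def)
  then have "det A = (\<Prod>i = 0..<N. A $$ (i, i))"
    using det_upper_triangular[OF _ c] prod_list_diag_prod[of A] c by simp
  also have "\<dots> = (\<Prod>i = 0..<k. A $$ (i, i)) * A $$ (k, k)"
    unfolding k[symmetric] by simp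
  also have "(\<Prod>i = 0..<k. A $$ (i, i)) = 1"
    using u k by (intro prod.neutral) (auto simp: unit_columns_def)
  finally have "A $$ (k, k) mod int p = 1 mod int p" using d by (simp add: cong_def)
  then show ?thesis using SL_index_mod[OF p A, of k k] k prime_gt_1_nat[OF p] by simp
qed

section \<open>Making a pivot 1 and clearing its column\<close>

lemma normalise_pivot_from_below:
  assumes A: "A \<in> carrier (SL N p)" and u: "unit_columns N k A"
    and l: "k < l" "l < N" "A $$ (l, k) \<noteq> 0"
  obtains B where "B \<in> carrier (SL N p)" "reaches N p 1 A B" "unit_columns N k B" "B $$ (k, k) = 1"
proof -
  have "\<not> int p dvd A $$ (l, k)"
    using SL_index_mod[OF p A l(2), of k] l by (auto simp: dvd_eq_mod_eq_0)
  then have "coprime (A $$ (l, k)) (int p)"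
    using p by (metis coprime_commute prime_imp_coprime prime_nat_int_transfer)
  then obtain x where x: "[A $$ (l, k) * x = 1] (mod int p)"
    using cong_solve_coprime_int by blast
  have k: "k < N" "k \<noteq> l" using l by auto
  \<comment> \<open>With \<open>x\<close> inverse to the entry in row \<open>l\<close>, this
    multiple of row \<open>l\<close> adds \<open>1 - A $$ (k, k)\<close> to the pivot modulo
    \<open>p\<close>.\<close>
  define B where "B = transvection N p (x * (1 - A $$ (k, k))) k l \<otimes>\<^bsub>SL N p\<^esub> A"
  have "[A $$ (k, k) + (A $$ (l, k) * x) * (1 - A $$ (k, k)) = A $$ (k, k) + 1 * (1 - A $$ (k, k))] (mod int p)"
    using x by (intro cong_add cong_mult) auto
  then have "B $$ (k, k) = 1"
    using transvection_mult_index[OF p A k(1) l(2) k(1) k(1)] prime_gt_1_nat[OF p]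
    by (simp add: B_def cong_def algebra_simps)
  then show thesis
    using that[of B] transvection_mult_closed[OF A k(2)] reaches_transvection_mult[OF k(1) l(2) k(2)]
      unit_columns_transvection_mult[OF A u k(1) l(2)] l(1) by (simp add: B_def)
qed

lemma normalise_pivot:
  assumes A: "A \<in> carrier (SL N p)" and u: "unit_columns N k A" and k: "k < N"
  obtains B where "B \<in> carrier (SL N p)" "reaches N p 2 A B" "unit_columns N k B" "B $$ (k, k) = 1"
proof (cases "Suc k = N")
  case True
  then show thesis using that A u unit_last_pivot[OF A u] reaches_refl by blast
next
  case False
  have Suc_k: "Suc k < N" using k False by simp
  obtain l where l: "k \<le> l" "l < N" "A $$ (l, k) \<noteq> 0" using exists_pivot[OF A u k] by blast
  \<comment> \<open>At most one operation yields a nonzero entry strictly below the pivot. Only if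
    the entry in row \<open>Suc k\<close> is zero and the nonzero entry found is the pivot itself
    must row \<open>k\<close> be added to row \<open>Suc k\<close>.\<close>
  obtain A' l' where A': "A' \<in> carrier (SL N p)" "reaches N p 1 A A'" "unit_columns N k A'"
    and l': "k < l'" "l' < N" "A' $$ (l', k) \<noteq> 0"
  proof (cases "A $$ (Suc k, k) = 0")
    case True
    show thesis
    proof (cases "l = k")
      case l_eq: True
      define B where "B = transvection N p 1 (Suc k) k \<otimes>\<^bsub>SL N p\<^esub> A"
      have "B $$ (Suc k, k) \<noteq> 0"
        using transvection_mult_index[OF p A Suc_k k Suc_k k] True l l_eq SL_index_mod[OF p A k k]
        by (simp add: B_def)
      then show thesis
        using that[of B "Suc k"] transvection_mult_closed[OF A] reaches_transvection_mult[OF Suc_k k]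
          unit_columns_transvection_mult[OF A u Suc_k k] Suc_k by (simp add: B_def)
    next
      case False
      then show thesis using that[of A l] A u l reaches_refl by simp
    qed
  next
    case nz: False
    then show thesis using that[of A "Suc k"] A u reaches_refl False k by simp
  qed
  obtain B where B: "B \<in> carrier (SL N p)" "reaches N p 1 A' B" "unit_columns N k B" "B $$ (k, k) = 1"
    by (rule normalise_pivot_from_below[OF A'(1,3) l'])
  have "reaches N p 2 A B" using reaches_trans[OF A A'(2) B(2)] by (simp only: one_add_one)
  then show thesis using that B by blast
qed

text \<open>One operation per row, each adding a multiple of the pivot row. That row itself never
  changes, so the pivot stays 1.\<close>

lemma clear_column:
  assumes A: "A \<in> carrier (SL N p)" and u: "unit_columns N k A" and k: "k < N" "A $$ (k, k) = 1"
    and m: "m \<le> N"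
  shows "\<exists>B \<in> carrier (SL N p). reaches N p m A B \<and> unit_columns N k B \<and> B $$ (k, k) = 1 \<and>
    (\<forall>i<m. i \<noteq> k \<longrightarrow> B $$ (i, k) = 0)"
  using m
proof (induction m)
  case 0
  then show ?case using A u k reaches_refl by auto
next
  case (Suc m)
  then obtain B where B: "B \<in> carrier (SL N p)" "reaches N p m A B" "unit_columns N k B"
    "B $$ (k, k) = 1" "\<And>i. i < m \<Longrightarrow> i \<noteq> k \<Longrightarrow> B $$ (i, k) = 0" by auto
  show ?case
  proof (cases "m = k")
    case True
    \<comment> \<open>The pivot row is skipped, but one operation is charged for it to keep the
      count equal to the number of rows.\<close>
    have "reaches N p (Suc m) A B" using reaches_trans[OF A B(2) reaches_refl[OF B(1), of 1]] by simp
    then show ?thesis using B True by (intro bexI[of _ B]) (auto simp: less_Suc_eq)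
  next
    case False
    have m: "m < N" using Suc.prems by simp
    define D where "D = transvection N p (- B $$ (m, k)) m k \<otimes>\<^bsub>SL N p\<^esub> B"
    have D: "D \<in> carrier (SL N p)" "unit_columns N k D" "reaches N p 1 B D"
      unfolding D_def
      using transvection_mult_closed[OF B(1) False] reaches_transvection_mult[OF m k(1) False]
        unit_columns_transvection_mult[OF B(1,3) m k(1)] by auto
    note ix = transvection_mult_index[OF p B(1) m k(1) _ k(1), of _ "- B $$ (m, k)", folded D_def]
    have "reaches N p (Suc m) A D" using reaches_trans[OF A B(2) D(3)] by simp
    moreover have "D $$ (i, k) = 0" if "i < Suc m" "i \<noteq> k" for i
      using ix[of i] that B(4,5) m by (auto simp: less_Suc_eq)
    moreover have "D $$ (k, k) = 1" using ix[of k] B(4) k False by simp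
    ultimately show ?thesis using D(1,2) by blast
  qed
qed

section \<open>Elimination of all columns\<close>

lemma eliminate_columns:
  assumes A: "A \<in> carrier (SL N p)" and "k \<le> N"
  shows "\<exists>B \<in> carrier (SL N p). reaches N p (k * (N + 2)) A B \<and> unit_columns N k B"
  using assms(2)
proof (induction k)
  case 0
  then show ?case using A reaches_refl by (auto simp: unit_columns_def)
next
  case (Suc k)
  then obtain B where B: "B \<in> carrier (SL N p)" "reaches N p (k * (N + 2)) A B" "unit_columns N k B"
    by auto
  obtain D where D: "D \<in> carrier (SL N p)" "reaches N p 2 B D" "unit_columns N k D" "D $$ (k, k) = 1"
    using normalise_pivot[OF B(1,3)] Suc.prems by auto
  obtain F where F: "F \<in> carrier (SL N p)" "reaches N p N D F" "unit_columns N k F"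
    "F $$ (k, k) = 1" "\<forall>i<N. i \<noteq> k \<longrightarrow> F $$ (i, k) = 0"
    using clear_column[OF D(1,3) _ D(4) order.refl] Suc.prems by auto
  \<comment> \<open>Each column costs 2 operations for its pivot and \<open>N\<close> for
    clearing.\<close>
  have "reaches N p (k * (N + 2) + 2 + N) A F"
    using reaches_trans[OF A reaches_trans[OF A B(2) D(2)] F(2)] .
  then have "reaches N p (Suc k * (N + 2)) A F" by (simp add: algebra_simps)
  moreover have "unit_columns N (Suc k) F"
    using F(3-5) by (auto simp: unit_columns_def less_Suc_eq)
  ultimately show ?case using F(1) by blast
qed

text \<open>Full elimination gives \<open>g\<close> with product \<open>g A\<close> equal to the
  identity, so \<open>A\<close> is the inverse of \<open>g\<close> and lies in the same
  ball.\<close>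

lemma SL_subset_transvection_ball:
  "carrier (SL N p) \<subseteq> word_ball (SL N p) (transvections N p) (N * (N + 2))"
proof
  fix A assume A: "A \<in> carrier (SL N p)"
  obtain B where B: "B \<in> carrier (SL N p)" "reaches N p (N * (N + 2)) A B" "unit_columns N N B"
    using eliminate_columns[OF A order.refl] by blast
  have "B \<in> carrier_mat N N" using B(1) SL_carrier_iff[OF p] by auto
  then have "B = 1\<^sub>m N" using B(3) by (intro eq_matI) (auto simp: unit_columns_def)
  then obtain g where g: "g \<in> word_ball (SL N p) (transvections N p) (N * (N + 2))"
    "g \<otimes>\<^bsub>SL N p\<^esub> A = \<one>\<^bsub>SL N p\<^esub>"
    using B(2) unfolding reaches_def one_SL by blast
  have "g \<in> carrier (SL N p)" using g(1) word_ball_subset_carrier[OF transvections_subset] by blast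
  then have "inv\<^bsub>SL N p\<^esub> g = A" using g(2) A by (metis inv_equality inv_inv)
  then show "A \<in> word_ball (SL N p) (transvections N p) (N * (N + 2))"
    using inv_in_word_ball[OF transvections_subset g(1)] by simp
qed

section \<open>From transvections to elementary generators, and the constant\<close>

lemma cayley_diam_SL_le:
  assumes N: "N \<ge> 3" and m: "p \<le> 2 ^ m"
  shows "cayley_diam (SL N p) {elementary_mat N i j | i j. i < N \<and> j < N \<and> i \<noteq> j}
    \<le> enat (N * (N + 2) * (12 * m + 4))"
proof -
  let ?X = "{elementary_mat N i j | i j. i < N \<and> j < N \<and> i \<noteq> j}"
  have X: "?X \<subseteq> carrier (SL N p)"
    using elementary_mat_eq_transvection[OF p] transvection_in_SL[OF p] by auto
  have "transvections N p \<subseteq> word_ball (SL N p) ?X (12 * m + 4)"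
    using transvection_in_word_ball[OF p N _ _ _ m] unfolding transvections_def by blast
  then show ?thesis
    using word_ball_trans[OF X] SL_subset_transvection_ball by (intro cayley_diam_le) blast
qed

end

lemma exists_power_two_ge:
  assumes "2 \<le> (p::nat)"
  obtains m where "p \<le> 2 ^ m" "12 * real m + 4 \<le> 28 * log 2 (real p)"
proof
  let ?m = "nat \<lceil>log 2 (real p)\<rceil>"
  have p: "2 \<le> real p" using assms by simp
  then have log1: "1 \<le> log 2 (real p)" by (subst le_log_iff) auto
  have "real p = 2 powr (log 2 (real p))" using p by (subst powr_log_cancel) auto
  also have "\<dots> \<le> 2 powr (real ?m)" by (rule powr_mono[OF real_nat_ceiling_ge]) simp
  also have "\<dots> = 2 ^ ?m" by (rule powr_realpow) simp
  finally have "real p \<le> real (2 ^ ?m)" by simp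
  then show "p \<le> 2 ^ ?m" by (simp only: of_nat_le_iff)
  have "real ?m \<le> log 2 (real p) + 1"
    using log1 of_int_ceiling_le_add_one[of "log 2 (real p)"] by simp
  \<comment> \<open>\<open>12 * (log 2 p + 1) + 4\<close> is at most \<open>28 * log 2 p\<close>
    because \<open>log 2 p \<ge> 1\<close>.\<close>
  then show "12 * real ?m + 4 \<le> 28 * log 2 (real p)" using log1 by linarith
qed

theorem theorem5p1:
  shows "\<exists>C::real. C > 0 \<and> (\<forall>N p :: nat. N \<ge> 3 \<longrightarrow> prime p \<longrightarrow>
    ereal_of_enat (cayley_diam (SL N p) {elementary_mat N i j | i j. i < N \<and> j < N \<and> i \<noteq> j})
      \<le> ereal (C * real N ^ 2 * ln (real p)))"
proof (intro exI[of _ "56 / ln 2"] conjI allI impI)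
  fix N p :: nat
  assume N: "N \<ge> 3" and p: "prime p"
  obtain m where m: "p \<le> 2 ^ m" "12 * real m + 4 \<le> 28 * log 2 (real p)"
    by (rule exists_power_two_ge[OF prime_ge_2_nat[OF p]])
  \<comment> \<open>The estimate \<open>N + 2 \<le> 2 * N\<close> contributes a factor 2 and the
    logarithmic bound a factor 28 with base 2, which gives \<open>56 / ln 2\<close>.\<close>
  have "N * (N + 2) \<le> N * (2 * N)" using N by (intro mult_le_mono2) simp
  then have "real (N * (N + 2)) \<le> real (N * (2 * N))" by (simp only: of_nat_le_iff)
  then have "real (N * (N + 2)) \<le> 2 * real N ^ 2" by (simp add: power2_eq_square mult.left_commute)
  then have "real (N * (N + 2)) * (12 * real m + 4) \<le> 2 * real N ^ 2 * (28 * log 2 (real p))"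
    using m(2) by (intro mult_mono) auto
  then have "real (N * (N + 2) * (12 * m + 4)) \<le> 56 / ln 2 * real N ^ 2 * ln (real p)"
    by (simp add: log_def mult.commute mult.left_commute)
  then show "ereal_of_enat (cayley_diam (SL N p) {elementary_mat N i j | i j. i < N \<and> j < N \<and> i \<noteq> j})
      \<le> ereal (56 / ln 2 * real N ^ 2 * ln (real p))"
    using order_trans[OF iffD2[OF ereal_of_enat_le_iff cayley_diam_SL_le[OF p N m(1)]]]
    by (simp only: ereal_of_enat_simps ereal_less_eq)
qed simp

end
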